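(* Consider the linear programs (P) minimize $c^\top x$ subject to $Ax=b$, $x\ge0$, and (D) maximize $b^\top y$ subject to $A^\top y\le c$, where $A\in\mathbb{R}^{m\times n}$, $b\in\mathbb{R}^m$, $c\in\mathbb{R}^n$. Let $\eta,\tau>0$ satisfy $\eta\tau\|A\|_2^2<1$, let $T$ be the primal-dual hybrid gradient operator with step sizes $\eta,\tau$, and let $v=(v_x,v_y)$ be its infimal displacement vector. Then (P) is infeasible if and only if $v_y$ is a nonzero vector, and in this case $v_y$ is an infeasibility certificate for (P), i.e. $b^\top v_y<0$ and $A^\top v_y\ge0$. Analogously, (D) is infeasible if and only if $v_x$ is a nonzero vector, and in this case $v_x$ is an infeasibility certificate for (D), i.e. $c^\top v_x<0$, $Av_x=0$ and $v_x\ge0$.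
   Context: The operator $T:\mathbb{R}^{n+m}\to\mathbb{R}^{n+m}$ is $T(x,y)=(x^+,y^+)$ with $x^+=\mathrm{proj}_{\mathbb{R}^n_+}(x-\eta A^\top y-\eta c)$ and $y^+=y+\tau A(2x^+-x)-\tau b$. $\|A\|_2$ is the spectral norm. Let $M=\begin{bmatrix}\frac1\eta I_n & -A^\top\\ -A&\frac1\tau I_m\end{bmatrix}$, positive definite when $\eta\tau\|A\|_2^2<1$, and $\|z\|_M=\sqrt{z^\top Mz}$. $T$ is nonexpansive with respect to $\|\cdot\|_M$, $\mathrm{cl}(\mathrm{range}(T-I))$ is convex, and the infimal displacement vector $v=(v_x,v_y)\in\mathbb{R}^n\times\mathbb{R}^m$ is its unique element of minimum $\|\cdot\|_M$-norm. *)

theory Defs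
  imports "HOL-Analysis.Analysis"
begin

text \<open>
  Inequalities between vectors are the library's componentwise order on \<^typ>\<open>real^'n\<close>;
  in particular \<^term>\<open>{0..} :: (real^'n) set\<close> is the nonnegative orthant.
\<close>

definition primal_feasible_set :: "real^'n^'m \<Rightarrow> real^'m \<Rightarrow> (real^'n) set" where
  "primal_feasible_set A b = {x. A *v x = b \<and> 0 \<le> x}"

definition dual_feasible_set :: "real^'n^'m \<Rightarrow> real^'n \<Rightarrow> (real^'m) set" where
  "dual_feasible_set A c = {y. transpose A *v y \<le> c}"

definition pdhg ::
  "real^'n^'m \<Rightarrow> real^'m \<Rightarrow> real^'n \<Rightarrow> real \<Rightarrow> real \<Rightarrow> (real^'n) \<times> (real^'m) \<Rightarrow> (real^'n) \<times> (real^'m)"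
where
  "pdhg A b c \<eta> \<tau> = (\<lambda>(x, y).
     let x' = closest_point {0..} (x - \<eta> *\<^sub>R (transpose A *v y) - \<eta> *\<^sub>R c);
         y' = y + \<tau> *\<^sub>R (A *v (2 *\<^sub>R x' - x)) - \<tau> *\<^sub>R b
     in (x', y'))"

text \<open>
  The action on pairs \<open>(x, y)\<close> of the block matrix with rows \<open>(1/\<eta> I, - A\<^sup>T)\<close> and
  \<open>(- A, 1/\<tau> I)\<close>.
\<close>

definition pdhg_matrix ::
  "real^'n^'m \<Rightarrow> real \<Rightarrow> real \<Rightarrow> (real^'n) \<times> (real^'m) \<Rightarrow> (real^'n) \<times> (real^'m)"
where
  "pdhg_matrix A \<eta> \<tau> = (\<lambda>(x, y).
     ((1 / \<eta>) *\<^sub>R x - transpose A *v y, - (A *v x) + (1 / \<tau>) *\<^sub>R y))"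

definition pdhg_norm :: "real^'n^'m \<Rightarrow> real \<Rightarrow> real \<Rightarrow> (real^'n) \<times> (real^'m) \<Rightarrow> real" where
  "pdhg_norm A \<eta> \<tau> z = sqrt (z \<bullet> pdhg_matrix A \<eta> \<tau> z)"

text \<open>
  The element of minimum norm exists and is unique if \<open>\<eta>, \<tau> > 0\<close> and
  \<open>\<eta> \<tau> \<parallel>A\<parallel>\<^sup>2 < 1\<close> for the spectral norm of \<open>A\<close>: the norm is then induced by an inner
  product, and the closure of the range is convex.
\<close>

definition infimal_displacement ::
  "real^'n^'m \<Rightarrow> real^'m \<Rightarrow> real^'n \<Rightarrow> real \<Rightarrow> real \<Rightarrow> (real^'n) \<times> (real^'m)"
where
  "infimal_displacement A b c \<eta> \<tau> =
     (THE v. is_arg_min (pdhg_norm A \<eta> \<tau>)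
               (\<lambda>w. w \<in> closure (range (\<lambda>z. pdhg A b c \<eta> \<tau> z - z))) v)"

end

theory Submission
  imports Defs
begin

text \<open>
  Write \<open>M\<close> for the block matrix of the norm and \<open>(g, h) = M (T z - z)\<close>. Rearranging the definition
  of \<open>T\<close> shows that the primal-dual pair \<open>(x\<^sup>+, - y\<^sup>+)\<close> satisfies the feasibility and
  complementarity conditions of the linear program with data \<open>A, b + h, c + g\<close>. By strong duality,
  \<open>M\<close> thus maps the range of \<open>T - I\<close> onto the product of the closed convex sets of all \<open>g\<close> with
  \<open>A\<^sup>T y \<le> c + g\<close> feasible and all \<open>h\<close> with \<open>A x = b + h, x \<ge> 0\<close> feasible, which are translates
  of finitely generated cones. The variational inequality \<open>v \<bullet> (M w - M v) \<ge> 0\<close> of the element \<open>v\<close>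
  of minimum norm then splits into one for \<open>v\<^sub>x\<close> and one for \<open>v\<^sub>y\<close>, which yield
  \<open>c \<bullet> v\<^sub>x = - \<parallel>v\<^sub>x\<parallel>\<^sup>2 / \<eta>\<close>, \<open>b \<bullet> v\<^sub>y = - \<parallel>v\<^sub>y\<parallel>\<^sup>2 / \<tau>\<close> and the remaining certificate conditions.
\<close>

text \<open>This rule would rewrite every \<open>transpose A *v x\<close> into the vector-matrix product \<open>x v* A\<close>.\<close>

declare transpose_matrix_vector [simp del]

section \<open>The nonnegative orthant: self-duality and projection\<close>

lemma nonneg_iff_inner_nonneg:
  fixes a :: "'a::ordered_euclidean_space"
  shows "0 \<le> a \<longleftrightarrow> (\<forall>x\<ge>0. 0 \<le> a \<bullet> x)"
proof (intro iffI allI impI)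
  fix x :: 'a
  assume "0 \<le> a" "0 \<le> x"
  then show "0 \<le> a \<bullet> x"
    by (subst euclidean_inner) (auto simp: eucl_le[where 'a='a] intro!: sum_nonneg mult_nonneg_nonneg)
next
  assume *: "\<forall>x\<ge>0. 0 \<le> a \<bullet> x"
  have "0 \<le> i" if "i \<in> Basis" for i :: 'a
    using that by (auto simp: eucl_le[where 'a='a] inner_Basis)
  with * show "0 \<le> a"
    by (auto simp: eucl_le[where 'a='a])
qed

lemma inner_nonneg:
  fixes a :: "'a::ordered_euclidean_space"
  assumes "0 \<le> a" "0 \<le> x"
  shows "0 \<le> a \<bullet> x"
  using assms nonneg_iff_inner_nonneg by blast

text \<open>On a cone, the variational inequality of the projection, tested at \<open>0\<close> and
  \<open>2 *\<^sub>R p\<close>, yields orthogonality; what remains says that \<open>p - z\<close>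
  lies in the dual cone, the orthant itself. This turns the projection in \<open>pdhg\<close> into
  complementary slackness.\<close>

lemma closest_point_nonneg_iff:
  fixes z :: "'a::ordered_euclidean_space"
  shows "closest_point {0..} z = p \<longleftrightarrow> 0 \<le> p \<and> 0 \<le> p - z \<and> (p - z) \<bullet> p = 0"
proof
  assume p: "closest_point {0..} z = p"
  have conv: "convex ({0..} :: 'a set)"
    by (auto simp: convex_def intro!: add_nonneg_nonneg scaleR_nonneg_nonneg)
  have "p \<in> {0..}"
    unfolding p[symmetric] by (rule closest_point_in_set) auto
  then have "0 \<le> p" by simp
  have dot: "0 \<le> (p - z) \<bullet> (x - p)" if "0 \<le> x" for x
    using closest_point_dot[OF conv closed_eucl_atLeast, of x z] that
    by (simp add: p inner_diff)
  have "(p - z) \<bullet> p = 0"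
    using dot[of 0] dot[of "2 *\<^sub>R p"] \<open>0 \<le> p\<close>
    by (simp add: scaleR_2 inner_simps add_nonneg_nonneg)
  moreover from this have "0 \<le> p - z"
    unfolding nonneg_iff_inner_nonneg[of "p - z"] using dot by (simp add: inner_diff_right)
  ultimately show "0 \<le> p \<and> 0 \<le> p - z \<and> (p - z) \<bullet> p = 0"
    using \<open>0 \<le> p\<close> by simp
next
  assume p: "0 \<le> p \<and> 0 \<le> p - z \<and> (p - z) \<bullet> p = 0"
  have conv: "convex ({0..} :: 'a set)"
    by (auto simp: convex_def intro!: add_nonneg_nonneg scaleR_nonneg_nonneg)
  have "dist z p \<le> dist z x" if "0 \<le> x" for x
  proof -
    have "0 \<le> (p - z) \<bullet> x"
      using p that by (simp add: inner_nonneg)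
    then have "0 \<le> (p - z) \<bullet> (x - p)"
      using p by (simp add: inner_diff_right)
    moreover have "(z - x) \<bullet> (z - x)
        = (z - p) \<bullet> (z - p) + (x - p) \<bullet> (x - p) + 2 * ((p - z) \<bullet> (x - p))"
      by (simp add: inner_simps inner_commute)
    ultimately have "(z - p) \<bullet> (z - p) \<le> (z - x) \<bullet> (z - x)"
      using inner_ge_zero[of "x - p"] by linarith
    then show ?thesis
      by (simp add: dist_norm norm_le)
  qed
  with p show "closest_point {0..} z = p"
    using closest_point_unique[OF conv closed_eucl_atLeast, of p z] by simp
qed

section \<open>Finitely generated cones and Farkas' lemma\<close>

lemma nonneg_eq_convex_cone_hull_Basis:
  "({0..} :: 'a::ordered_euclidean_space set) = convex_cone hull Basis"
proof
  show "{0..} \<subseteq> convex_cone hull (Basis :: 'a set)"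
  proof
    fix x :: 'a
    assume x: "x \<in> {0..}"
    have "(\<Sum>i\<in>F. (x \<bullet> i) *\<^sub>R i) \<in> convex_cone hull Basis" if "finite F" "F \<subseteq> Basis" for F
      using that
    proof (induction F)
      case empty
      show ?case by (simp add: convex_cone_hull_contains_0)
    next
      case (insert i F)
      then have "(x \<bullet> i) *\<^sub>R i \<in> convex_cone hull Basis"
        using x by (intro convex_cone_hull_mul hull_inc) (auto simp: eucl_le[where 'a='a])
      then show ?case
        using insert by (auto intro: convex_cone_hull_add)
    qed
    from this[OF finite_Basis order_refl] show "x \<in> convex_cone hull Basis"
      by (simp add: euclidean_representation)
  qed
next
  have "convex_cone ({0..} :: 'a set)"
    by (auto simp: convex_cone_iff intro: add_nonneg_nonneg scaleR_nonneg_nonneg)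
  then show "convex_cone hull Basis \<subseteq> ({0..} :: 'a set)"
    by (intro hull_minimal) (auto simp: eucl_le[where 'a='a] inner_Basis)
qed

lemma convex_cone_linear_image_nonneg:
  fixes f :: "'a::ordered_euclidean_space \<Rightarrow> 'b::euclidean_space"
  assumes "linear f"
  shows "convex_cone (f ` {0..})"
  by (simp add: nonneg_eq_convex_cone_hull_Basis assms convex_cone_linear_image
      convex_cone_convex_cone_hull)

text \<open>Linear images of closed cones can fail to be closed. Here the image is generated by the
  finitely many images of basis vectors, and finitely generated cones are closed.\<close>

lemma closed_linear_image_nonneg:
  fixes f :: "'a::ordered_euclidean_space \<Rightarrow> 'b::euclidean_space"
  assumes "linear f"
  shows "closed (f ` {0..})"
proof -
  have "f ` {0..} = convex_cone hull (f ` Basis)"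
  proof
    have "{0..} \<subseteq> f -` (convex_cone hull (f ` Basis))"
      unfolding nonneg_eq_convex_cone_hull_Basis
    proof (rule hull_minimal)
      show "convex_cone (f -` (convex_cone hull f ` Basis))"
        using assms
        by (auto simp: convex_cone_iff linear_0 linear_add linear_scale convex_cone_hull_contains_0
            intro: convex_cone_hull_add convex_cone_hull_mul)
    qed (auto intro: hull_inc)
    then show "f ` {0..} \<subseteq> convex_cone hull (f ` Basis)"
      by blast
    show "convex_cone hull (f ` Basis) \<subseteq> f ` {0..}"
      by (intro hull_minimal convex_cone_linear_image_nonneg assms image_mono)
        (auto simp: eucl_le[where 'a='a] inner_Basis)
  qed
  then show ?thesis
    by (simp add: closed_convex_cone_hull)
qed

text \<open>Strict separation of \<open>z\<close> from the closed cone gives a bound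
  \<open>\<beta>\<close>, negative because the cone contains 0. A negative value on the cone could
  be scaled to violate that bound.\<close>

lemma Farkas:
  fixes f :: "'a::ordered_euclidean_space \<Rightarrow> 'b::euclidean_space"
  assumes "linear f" "z \<notin> f ` {0..}"
  obtains a where "a \<bullet> z < 0" "\<And>x. 0 \<le> x \<Longrightarrow> 0 \<le> a \<bullet> f x"
proof -
  have cone: "convex_cone (f ` {0..})"
    using assms by (simp add: convex_cone_linear_image_nonneg)
  then have "convex (f ` {0..})"
    by (simp add: convex_cone_def)
  then obtain a \<beta> where a: "a \<bullet> z < \<beta>" and gt: "\<And>u. u \<in> f ` {0..} \<Longrightarrow> \<beta> < a \<bullet> u"
    using separating_hyperplane_closed_point[OF _ closed_linear_image_nonneg] assms by metis
  have "\<beta> < 0"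
    using gt[of 0] convex_cone_contains_0[OF cone] by simp
  have nonneg: "0 \<le> a \<bullet> f x" if "0 \<le> x" for x
  proof (rule ccontr)
    assume neg: "\<not> 0 \<le> a \<bullet> f x"
    \<comment> \<open>This factor gives \<open>k *\<^sub>R f x\<close> exactly the value
      \<open>\<beta>\<close>, which strict separation excludes.\<close>
    define k where "k = \<beta> / (a \<bullet> f x)"
    have "0 \<le> k"
      using neg \<open>\<beta> < 0\<close> by (simp add: k_def divide_nonpos_neg)
    then have "\<beta> < a \<bullet> (k *\<^sub>R f x)"
      using that by (intro gt convex_cone_scaleR[OF cone]) auto
    then show False
      using neg by (simp add: k_def)
  qed
  from a \<open>\<beta> < 0\<close> have "a \<bullet> z < 0" by simp
  from that[OF this nonneg] show thesis .
qed

section \<open>Strong duality of linear programming\<close>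

lemma inner_matrix_vector_mult:
  fixes A :: "real^'n^'m"
  shows "x \<bullet> (A *v y) = (transpose A *v x) \<bullet> y"
  by (metis dot_lmul_matrix transpose_matrix_vector)

lemma matrix_vector_mult_minus:
  fixes A :: "real^'n^'m"
  shows "A *v (- x) = - (A *v x)"
  using matrix_vector_mult_diff_distrib[of A 0 x] by simp

lemma matrix_vector_mult_reflection:
  fixes A :: "real^'n^'m"
  shows "A *v (2 *\<^sub>R p - x) = A *v p + (A *v p - A *v x)"
  unfolding matrix_vector_mult_diff_distrib matrix_vector_mult_scaleR
  unfolding scaleR_2 by (rule add_diff_eq[symmetric])

text \<open>Feasibility of both programs and absence of a gap form one cone membership. A Farkas
  certificate \<open>(u, w, t)\<close> against it would violate weak duality.\<close>

lemma lp_complementary_solution: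
  fixes A :: "real^'n^'m"
  assumes "primal_feasible_set A b \<noteq> {}" "dual_feasible_set A c \<noteq> {}"
  obtains x y where "x \<in> primal_feasible_set A b" "y \<in> dual_feasible_set A c"
    "(c - transpose A *v y) \<bullet> x = 0"
proof -
  \<comment> \<open>The image of the nonnegative orthant under \<open>f\<close> contains \<open>(b, c, 0)\<close> iff there is a feasible
    pair \<open>(x, p - q)\<close> without duality gap; \<open>s\<close> and \<open>r\<close> are slack variables.\<close>
  define f :: "(real^'n) \<times> ((real^'m) \<times> (real^'m)) \<times> (real^'n) \<times> real \<Rightarrow> (real^'m) \<times> (real^'n) \<times> real"
    where "f = (\<lambda>(x, (p, q), s, r).
      (A *v x, transpose A *v (p - q) + s, c \<bullet> x - b \<bullet> (p - q) + r))"
  have lin: "linear f"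
    by (rule linearI) (simp_all add: f_def split_beta algebra_simps inner_simps)
  have "(b, c, 0) \<in> f ` {0..}"
  proof (rule ccontr)
    assume "(b, c, 0) \<notin> f ` {0..}"
    then obtain a where a: "a \<bullet> (b, c, 0) < 0" "\<And>x. 0 \<le> x \<Longrightarrow> 0 \<le> a \<bullet> f x"
      using Farkas[OF lin] by blast
    obtain u w t where uwt: "a = (u, w, t)"
      by (cases a) auto
    have neg: "u \<bullet> b + w \<bullet> c < 0"
      using a(1) by (simp add: uwt)
    have pos: "0 \<le> u \<bullet> (A *v x) + w \<bullet> (transpose A *v (p - q) + s) + t * (c \<bullet> x - b \<bullet> (p - q) + r)"
      if "0 \<le> x" "0 \<le> p" "0 \<le> q" "0 \<le> s" "0 \<le> r" for x p q s r
      using a(2)[of "(x, (p, q), s, r)"] that by (simp add: uwt f_def less_eq_prod_def zero_prod_def)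
    \<comment> \<open>Setting all blocks but one to zero in \<open>pos\<close> isolates the
      condition that each block imposes on the certificate. The opposite signs of \<open>p\<close>
      and \<open>q\<close> produce an equation.\<close>
    have "0 \<le> t"
      using pos[of 0 0 0 0 1] by simp
    have "0 \<le> w"
      unfolding nonneg_iff_inner_nonneg[of w] using pos[of 0 0 0 _ 0] by simp
    have "0 \<le> (transpose A *v u + t *\<^sub>R c) \<bullet> x" if "0 \<le> x" for x
      using pos[of x 0 0 0 0] that by (simp add: inner_simps inner_matrix_vector_mult)
    then have dual: "0 \<le> transpose A *v u + t *\<^sub>R c"
      by (simp add: nonneg_iff_inner_nonneg[of "transpose A *v u + t *\<^sub>R c"])
    have "0 \<le> (A *v w - t *\<^sub>R b) \<bullet> p" "0 \<le> - (A *v w - t *\<^sub>R b) \<bullet> p" if "0 \<le> p" for p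
      using pos[of 0 p 0 0 0] pos[of 0 0 p 0 0] that
      by (simp_all add: inner_simps inner_matrix_vector_mult)
    then have "0 \<le> A *v w - t *\<^sub>R b" "0 \<le> - (A *v w - t *\<^sub>R b)"
      by (subst nonneg_iff_inner_nonneg; blast)+
    then have "A *v w - t *\<^sub>R b = 0"
      by (metis neg_0_le_iff_le order_antisym)
    then have primal: "A *v w = t *\<^sub>R b" by simp
    show False
    proof (cases "t = 0")
      \<comment> \<open>Here \<open>u\<close> and \<open>w\<close> satisfy the homogeneous
        constraints, so pairing them with the given feasible points bounds both terms of
        \<open>neg\<close> below by 0.\<close>
      case True
      obtain x y where x: "A *v x = b" "0 \<le> x" and y: "transpose A *v y \<le> c"
        using assms by (auto simp: primal_feasible_set_def dual_feasible_set_def)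
      have "0 \<le> (transpose A *v u) \<bullet> x"
        using dual x True by (simp add: inner_nonneg)
      then have "0 \<le> u \<bullet> b"
        by (simp flip: inner_matrix_vector_mult x(1))
      moreover have "0 \<le> w \<bullet> (c - transpose A *v y)"
        using y \<open>0 \<le> w\<close> by (intro inner_nonneg) auto
      then have "0 \<le> w \<bullet> c"
        using primal True by (simp add: inner_diff inner_matrix_vector_mult)
      ultimately show False using neg by simp
    next
      \<comment> \<open>After division by \<open>t > 0\<close>, \<open>w\<close> is primal feasible
        and \<open>- u\<close> dual feasible, and \<open>neg\<close> would be a negative duality
        gap.\<close>
      case False
      have "0 \<le> (transpose A *v u + t *\<^sub>R c) \<bullet> w"
        using dual \<open>0 \<le> w\<close> by (rule inner_nonneg)
      also have "\<dots> = t * (u \<bullet> b + w \<bullet> c)"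
        by (simp add: inner_simps primal inner_commute[of c] algebra_simps
            flip: inner_matrix_vector_mult)
      finally show False
        using neg False \<open>0 \<le> t\<close> by (simp add: zero_le_mult_iff)
    qed
  qed
  then obtain x p q s r where xs: "0 \<le> x" "0 \<le> s" "0 \<le> r" "A *v x = b"
    "c = transpose A *v (p - q) + s" "c \<bullet> x - b \<bullet> (p - q) + r = 0"
    by (auto simp: f_def less_eq_prod_def zero_prod_def)
  \<comment> \<open>The duality gap equals \<open>s \<bullet> x\<close>, which is nonnegative by
    signs and equals \<open>- r\<close>, hence vanishes.\<close>
  have "s \<bullet> x = c \<bullet> x - b \<bullet> (p - q)"
    unfolding xs(5) by (simp add: inner_simps flip: inner_matrix_vector_mult)
      (simp add: xs(4) inner_simps inner_commute)
  with xs inner_nonneg[of s x] have "s \<bullet> x = 0" by simp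
  with xs that[of x "p - q"] show thesis
    by (simp add: primal_feasible_set_def dual_feasible_set_def)
qed

section \<open>Cones of data with feasible programs\<close>

lemma primal_feasible_right_hand_sides:
  "{b. primal_feasible_set A b \<noteq> {}} = (\<lambda>x. A *v x) ` {0..}"
  by (auto simp: primal_feasible_set_def)

text \<open>Writing the free variable as \<open>p - q\<close> and adding a slack \<open>s\<close>
  exhibits the set as a linear image of an orthant, hence as a closed convex cone.\<close>

lemma dual_feasible_right_hand_sides:
  fixes A :: "real^'n^'m"
  shows "{c. dual_feasible_set A c \<noteq> {}} = (\<lambda>(p, q, s). transpose A *v (p - q) + s) ` {0..}"
proof -
  have split: "\<exists>p q. 0 \<le> p \<and> 0 \<le> q \<and> y = p - q" for y :: "real^'m"
    by (intro exI[of _ "\<chi> i. max (y $ i) 0"] exI[of _ "\<chi> i. max (- y $ i) 0"])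
      (auto simp: less_eq_vec_def vec_eq_iff max_def)
  show ?thesis
  proof (intro equalityI subsetI)
    fix c
    assume "c \<in> {c. dual_feasible_set A c \<noteq> {}}"
    then obtain y where "transpose A *v y \<le> c"
      by (auto simp: dual_feasible_set_def)
    moreover obtain p q where "0 \<le> p" "0 \<le> q" "y = p - q"
      using split by blast
    ultimately show "c \<in> (\<lambda>(p, q, s). transpose A *v (p - q) + s) ` {0..}"
      by (intro image_eqI[of _ _ "(p, q, c - transpose A *v y)"])
         (auto simp: less_eq_prod_def zero_prod_def)
  next
    fix c
    assume "c \<in> (\<lambda>(p, q, s). transpose A *v (p - q) + s) ` {0..}"
    then obtain p q s where "0 \<le> s" "c = transpose A *v (p - q) + s"
      by (auto simp: less_eq_prod_def zero_prod_def)
    then have "p - q \<in> dual_feasible_set A c"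
      by (simp add: dual_feasible_set_def)
    then show "c \<in> {c. dual_feasible_set A c \<noteq> {}}"
      by blast
  qed
qed

lemma
  fixes A :: "real^'n^'m"
  shows closed_primal_feasible: "closed {b. primal_feasible_set A b \<noteq> {}}"
    and convex_cone_primal_feasible: "convex_cone {b. primal_feasible_set A b \<noteq> {}}"
    and closed_dual_feasible: "closed {c. dual_feasible_set A c \<noteq> {}}"
    and convex_cone_dual_feasible: "convex_cone {c. dual_feasible_set A c \<noteq> {}}"
proof -
  have "linear (\<lambda>(p, q, s). transpose A *v (p - q) + s)"
    by (rule linearI) (simp_all add: split_beta algebra_simps)
  then show "closed {c. dual_feasible_set A c \<noteq> {}}" "convex_cone {c. dual_feasible_set A c \<noteq> {}}"
    "closed {b. primal_feasible_set A b \<noteq> {}}" "convex_cone {b. primal_feasible_set A b \<noteq> {}}"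
    unfolding primal_feasible_right_hand_sides dual_feasible_right_hand_sides
    by (intro closed_linear_image_nonneg convex_cone_linear_image_nonneg
        matrix_vector_mul_linear; simp)+
qed

section \<open>Symmetry and positive definiteness of the block matrix\<close>

lemma linear_pdhg_matrix: "linear (pdhg_matrix A \<eta> \<tau>)"
  by (rule linearI) (simp_all add: pdhg_matrix_def split_beta algebra_simps)

lemma pdhg_matrix_symmetric: "z \<bullet> pdhg_matrix A \<eta> \<tau> w = pdhg_matrix A \<eta> \<tau> z \<bullet> w"
proof (cases z, cases w)
  fix x y x' y'
  assume "z = (x, y)" "w = (x', y')"
  then show ?thesis
    by (simp add: pdhg_matrix_def inner_simps inner_matrix_vector_mult)
qed

text \<open>The cross term is at most the fraction \<open>k = sqrt (\<eta> * \<tau>) * L\<close> of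
  the diagonal part, by Cauchy-Schwarz and the inequality of means; the step size condition says
  \<open>k < 1\<close>.\<close>

lemma pdhg_matrix_coercive:
  fixes A :: "real^'n^'m"
  assumes "\<eta> > 0" "\<tau> > 0" "\<eta> * \<tau> * (onorm (\<lambda>x. A *v x))\<^sup>2 < 1"
  obtains \<alpha> where "\<alpha> > 0" "\<And>z. \<alpha> * (z \<bullet> z) \<le> z \<bullet> pdhg_matrix A \<eta> \<tau> z"
proof -
  define L where "L = onorm (\<lambda>x. A *v x)"
  define k where "k = sqrt (\<eta> * \<tau>) * L"
  define \<alpha> where "\<alpha> = (1 - k) * min (1 / \<eta>) (1 / \<tau>)"
  have "0 \<le> L"
    unfolding L_def by (rule onorm_pos_le) simp
  then have "0 \<le> k"
    using assms by (simp add: k_def)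
  have "k\<^sup>2 < 1"
    using assms by (simp add: k_def L_def power_mult_distrib)
  then have "k < 1"
    using \<open>0 \<le> k\<close> by (simp add: power_less_one_iff abs_square_less_1)
  then have "0 < \<alpha>"
    using assms by (simp add: \<alpha>_def)
  moreover have "\<alpha> * (z \<bullet> z) \<le> z \<bullet> pdhg_matrix A \<eta> \<tau> z" for z
  proof (cases z)
    case (Pair x y)
    \<comment> \<open>With these scalings \<open>p\<^sup>2 + q\<^sup>2\<close> is the diagonal part
      of the quadratic form, and the factor \<open>sqrt (\<eta> * \<tau>)\<close> in
      \<open>k\<close> compensates for them in the cross term.\<close>
    define p where "p = norm x / sqrt \<eta>"
    define q where "q = norm y / sqrt \<tau>"
    have sq: "p\<^sup>2 = (x \<bullet> x) / \<eta>" "q\<^sup>2 = (y \<bullet> y) / \<tau>"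
      using assms by (simp_all add: p_def q_def power_divide power2_norm_eq_inner)
    have "y \<bullet> (A *v x) \<le> norm y * norm (A *v x)"
      by (rule norm_cauchy_schwarz)
    also have "\<dots> \<le> norm y * (L * norm x)"
      unfolding L_def by (intro mult_left_mono onorm matrix_vector_mul_bounded_linear) simp
    also have "\<dots> = k * (p * q)"
      using assms by (simp add: k_def p_def q_def real_sqrt_mult)
    finally have "y \<bullet> (A *v x) \<le> k * (p * q)" .
    moreover have "2 * (k * (p * q)) \<le> k * (p\<^sup>2 + q\<^sup>2)"
      using mult_left_mono[OF sum_squares_bound[of p q] \<open>0 \<le> k\<close>] by (simp add: mult_ac)
    ultimately have "(1 - k) * (p\<^sup>2 + q\<^sup>2) \<le> p\<^sup>2 + q\<^sup>2 - 2 * (y \<bullet> (A *v x))"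
      by (simp add: algebra_simps)
    moreover have cross: "x \<bullet> (transpose A *v y) = y \<bullet> (A *v x)"
      by (metis inner_commute inner_matrix_vector_mult)
    then have "p\<^sup>2 + q\<^sup>2 - 2 * (y \<bullet> (A *v x)) = z \<bullet> pdhg_matrix A \<eta> \<tau> z"
      by (simp add: Pair pdhg_matrix_def sq inner_diff_right inner_add_right cross)
    ultimately have le: "(1 - k) * (p\<^sup>2 + q\<^sup>2) \<le> z \<bullet> pdhg_matrix A \<eta> \<tau> z"
      by simp
    have "min (1 / \<eta>) (1 / \<tau>) * (x \<bullet> x) \<le> 1 / \<eta> * (x \<bullet> x)"
      "min (1 / \<eta>) (1 / \<tau>) * (y \<bullet> y) \<le> 1 / \<tau> * (y \<bullet> y)"
      by (intro mult_right_mono; simp)+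
    then have "min (1 / \<eta>) (1 / \<tau>) * (z \<bullet> z) \<le> p\<^sup>2 + q\<^sup>2"
      by (simp add: Pair sq distrib_left)
    then have "\<alpha> * (z \<bullet> z) \<le> (1 - k) * (p\<^sup>2 + q\<^sup>2)"
      using \<open>k < 1\<close> by (simp add: \<alpha>_def mult.assoc)
    with le show ?thesis by simp
  qed
  ultimately show thesis using that by blast
qed

section \<open>Minimizers of a positive definite quadratic form on a closed convex set\<close>

text \<open>The variational inequality is the first-order condition along segments in
  \<open>S\<close>. Existence follows from compactness of a sublevel set, uniqueness from the
  variational inequality.\<close>

lemma quadratic_form_minimizer:
  fixes M :: "'a::euclidean_space \<Rightarrow> 'a"
  assumes "linear M" and sym: "\<And>x y. x \<bullet> M y = M x \<bullet> y"
    and "\<alpha> > 0" and coercive: "\<And>z. \<alpha> * (z \<bullet> z) \<le> z \<bullet> M z"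
    and "closed S" "convex S" "S \<noteq> {}"
  shows quadratic_form_minimizer_ex1: "\<exists>!v. is_arg_min (\<lambda>z. sqrt (z \<bullet> M z)) (\<lambda>w. w \<in> S) v"
    and quadratic_form_minimizer_variational:
      "\<And>v w. is_arg_min (\<lambda>z. sqrt (z \<bullet> M z)) (\<lambda>w. w \<in> S) v \<Longrightarrow> w \<in> S \<Longrightarrow> 0 \<le> v \<bullet> (M w - M v)"
proof -
  let ?min = "is_arg_min (\<lambda>z. sqrt (z \<bullet> M z)) (\<lambda>w. w \<in> S)"
  have min_iff: "?min v \<longleftrightarrow> v \<in> S \<and> (\<forall>w\<in>S. v \<bullet> M v \<le> w \<bullet> M w)" for v
    by (auto simp: is_arg_min_def not_less)
  have M_add: "M (x + y) = M x + M y" and M_scale: "M (t *\<^sub>R x) = t *\<^sub>R M x"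
    and M_diff: "M (x - y) = M x - M y" for x y t
    using \<open>linear M\<close> by (simp_all add: linear_add linear_scale linear_diff)
  show var: "0 \<le> v \<bullet> (M w - M v)" if "?min v" "w \<in> S" for v w
  proof (rule ccontr)
    assume neg: "\<not> ?thesis"
    define d where "d = w - v"
    define g where "g = v \<bullet> M d"
    have "g < 0"
      using neg by (simp add: g_def d_def M_diff)
    have d_g: "d \<bullet> M v = g"
      using sym[of v d] by (simp add: g_def inner_commute)
    \<comment> \<open>This is the increment of the form from \<open>v\<close> to
      \<open>v + t *\<^sub>R d\<close>, divided by \<open>t\<close>.\<close>
    have ge: "0 \<le> 2 * g + t * (d \<bullet> M d)" if t: "0 < t" "t \<le> 1" for t
    proof -
      have "v + t *\<^sub>R d = (1 - t) *\<^sub>R v + t *\<^sub>R w"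
        by (simp add: d_def algebra_simps)
      also have "\<dots> \<in> S"
        using \<open>convex S\<close> \<open>?min v\<close> \<open>w \<in> S\<close> t by (intro convexD) (auto simp: min_iff)
      finally have "v \<bullet> M v \<le> (v + t *\<^sub>R d) \<bullet> M (v + t *\<^sub>R d)"
        using \<open>?min v\<close> by (simp add: min_iff)
      also have "\<dots> = v \<bullet> M v + t * (2 * g + t * (d \<bullet> M d))"
        by (simp add: M_add M_scale inner_simps algebra_simps d_g flip: g_def)
      finally show ?thesis
        using t by (simp add: zero_le_mult_iff)
    qed
    have "0 \<le> d \<bullet> M d"
      using coercive[of d] \<open>\<alpha> > 0\<close> by (meson inner_ge_zero less_imp_le mult_nonneg_nonneg order_trans)
    \<comment> \<open>This \<open>t\<close> is small enough for
      \<open>t * (d \<bullet> M d) \<le> - g\<close>, so the bound in \<open>ge\<close> is at most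
      \<open>g < 0\<close>. The added 1 keeps the denominator positive.\<close>
    define t where "t = min 1 (- g / (d \<bullet> M d + 1))"
    have "0 < t" "t \<le> 1"
      using \<open>g < 0\<close> \<open>0 \<le> d \<bullet> M d\<close> by (auto simp: t_def divide_neg_pos)
    have "t * (d \<bullet> M d) \<le> t * (d \<bullet> M d + 1)"
      using \<open>0 < t\<close> by simp
    also have "\<dots> \<le> - g / (d \<bullet> M d + 1) * (d \<bullet> M d + 1)"
      using \<open>0 \<le> d \<bullet> M d\<close> by (intro mult_right_mono) (auto simp: t_def)
    also have "\<dots> = - g"
      using \<open>0 \<le> d \<bullet> M d\<close> by simp
    finally show False
      using ge[OF \<open>0 < t\<close> \<open>t \<le> 1\<close>] \<open>g < 0\<close> by linarith
  qed
  have "\<exists>v. ?min v"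
  proof -
    obtain u where "u \<in> S"
      using \<open>S \<noteq> {}\<close> by blast
    \<comment> \<open>By coercivity, every point with value at most that of \<open>u\<close> lies in
      this ball, so minimizing over the compact part of \<open>S\<close> inside it suffices.\<close>
    define r where "r = sqrt (u \<bullet> M u / \<alpha>)"
    have small: "w \<in> cball 0 r" if "w \<bullet> M w \<le> u \<bullet> M u" for w
    proof -
      have "\<alpha> * (norm w)\<^sup>2 \<le> u \<bullet> M u"
        using coercive[of w] that by (simp add: power2_norm_eq_inner)
      then have "(norm w)\<^sup>2 \<le> u \<bullet> M u / \<alpha>"
        using \<open>\<alpha> > 0\<close> by (simp add: field_simps)
      then show ?thesis
        by (simp add: r_def real_le_rsqrt)
    qed
    have "compact (S \<inter> cball 0 r)"
      using \<open>closed S\<close> by (simp add: closed_Int_compact)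
    moreover have "S \<inter> cball 0 r \<noteq> {}"
      using \<open>u \<in> S\<close> small by auto
    moreover have "continuous_on (S \<inter> cball 0 r) (\<lambda>z. z \<bullet> M z)"
      using \<open>linear M\<close> by (intro continuous_intros linear_continuous_on) (simp add: linear_linear)
    ultimately obtain v where v: "v \<in> S \<inter> cball 0 r"
      "\<And>w. w \<in> S \<inter> cball 0 r \<Longrightarrow> v \<bullet> M v \<le> w \<bullet> M w"
      using continuous_attains_inf by metis
    have "v \<bullet> M v \<le> w \<bullet> M w" if "w \<in> S" for w
    proof (cases "w \<in> cball 0 r")
      case True
      then show ?thesis
        using v(2)[of w] that by blast
    next
      case False
      then have "u \<bullet> M u < w \<bullet> M w"
        using small[of w] by linarith
      moreover have "v \<bullet> M v \<le> u \<bullet> M u"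
        using v(2)[of u] small[of u] \<open>u \<in> S\<close> by blast
      ultimately show ?thesis by linarith
    qed
    with v(1) show ?thesis
      by (auto simp: min_iff)
  qed
  moreover have "v = w" if "?min v" "?min w" for v w
  proof -
    \<comment> \<open>The sum of these two inequalities is
      \<open>(v - w) \<bullet> M (v - w) \<le> 0\<close>.\<close>
    have "0 \<le> v \<bullet> (M w - M v)" "0 \<le> w \<bullet> (M v - M w)"
      using that var min_iff by blast+
    then have "(v - w) \<bullet> M (v - w) \<le> 0"
      by (simp add: M_diff inner_simps)
    then have "(v - w) \<bullet> (v - w) \<le> 0"
      using coercive[of "v - w"] \<open>\<alpha> > 0\<close> by (smt (verit) inner_ge_zero mult_pos_pos)
    then have "(v - w) \<bullet> (v - w) = 0"
      using inner_ge_zero order_antisym by blast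
    then show ?thesis
      by simp
  qed
  ultimately show "\<exists>!v. ?min v"
    by (rule ex_ex1I)
qed

section \<open>The range of the displacement map\<close>

lemma range_pdhg_displacement:
  fixes A :: "real^'n^'m"
  assumes "\<eta> > 0" "\<tau> > 0"
  shows "range (\<lambda>z. pdhg A b c \<eta> \<tau> z - z) =
    {w. dual_feasible_set A (c + fst (pdhg_matrix A \<eta> \<tau> w)) \<noteq> {}
      \<and> primal_feasible_set A (b + snd (pdhg_matrix A \<eta> \<tau> w)) \<noteq> {}}"
    (is "range ?D = ?R")
proof (intro equalityI subsetI)
  fix w
  assume "w \<in> range ?D"
  then obtain x y where w: "w = ?D (x, y)"
    by auto
  define p where "p = closest_point {0..} (x - \<eta> *\<^sub>R (transpose A *v y) - \<eta> *\<^sub>R c)"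
  define s where "s = \<tau> *\<^sub>R (A *v (2 *\<^sub>R p - x)) - \<tau> *\<^sub>R b"
  have p: "0 \<le> p" "0 \<le> p - (x - \<eta> *\<^sub>R (transpose A *v y) - \<eta> *\<^sub>R c)"
    using closest_point_nonneg_iff p_def by blast+
  have w: "w = (p - x, s)"
    by (simp add: w pdhg_def Let_def s_def p_def)
  have "0 \<le> (1 / \<eta>) *\<^sub>R (p - (x - \<eta> *\<^sub>R (transpose A *v y) - \<eta> *\<^sub>R c))"
    using p assms by (intro scaleR_nonneg_nonneg) auto
  \<comment> \<open>The iteration adds \<open>transpose A *v y\<close> to \<open>c\<close>, so its
    \<open>y\<close> has the opposite sign to the variable of (D). The witness is the negated new
    iterate \<open>y + s\<close>.\<close>
  then have "transpose A *v (- y - s) \<le> c + fst (pdhg_matrix A \<eta> \<tau> w)"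
    using assms by (simp add: w pdhg_matrix_def matrix_vector_mult_minus algebra_simps)
  moreover have "(1 / \<tau>) *\<^sub>R s = A *v p + (A *v p - A *v x) - b"
    using assms by (simp add: s_def matrix_vector_mult_reflection scaleR_diff_right[symmetric])
  then have "A *v p = b + snd (pdhg_matrix A \<eta> \<tau> w)"
    by (simp add: w pdhg_matrix_def matrix_vector_mult_diff_distrib)
  ultimately show "w \<in> ?R"
    using p by (auto simp: primal_feasible_set_def dual_feasible_set_def)
next
  fix w
  assume "w \<in> ?R"
  obtain u s where w: "w = (u, s)"
    by (cases w)
  let ?g = "fst (pdhg_matrix A \<eta> \<tau> w)" and ?h = "snd (pdhg_matrix A \<eta> \<tau> w)"
  have "primal_feasible_set A (b + ?h) \<noteq> {}" "dual_feasible_set A (c + ?g) \<noteq> {}"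
    using \<open>w \<in> ?R\<close> by blast+
  then obtain p y where "p \<in> primal_feasible_set A (b + ?h)" "y \<in> dual_feasible_set A (c + ?g)"
    and compl: "(c + ?g - transpose A *v y) \<bullet> p = 0"
    by (rule lp_complementary_solution)
  then have p: "A *v p = b + ?h" "0 \<le> p" and y: "transpose A *v y \<le> c + ?g"
    by (simp_all add: primal_feasible_set_def dual_feasible_set_def)
  \<comment> \<open>The preimage is \<open>(p - u, - y - s)\<close>, to be sent to
    \<open>(p, - y)\<close>. The point to be projected is \<open>z\<close>; since
    \<open>p - z\<close> is \<open>\<eta>\<close> times the dual slack, complementarity makes its
    projection \<open>p\<close>.\<close>
  define z where "z = p - u - \<eta> *\<^sub>R (transpose A *v (- y - s)) - \<eta> *\<^sub>R c"
  have z: "p - z = \<eta> *\<^sub>R (c + ?g - transpose A *v y)"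
    using assms by (simp add: z_def w pdhg_matrix_def matrix_vector_mult_minus algebra_simps)
  have x': "closest_point {0..} (p - u - \<eta> *\<^sub>R (transpose A *v (- y - s)) - \<eta> *\<^sub>R c) = p"
    unfolding z_def[symmetric] closest_point_nonneg_iff z
    using assms p y compl by (auto intro: scaleR_nonneg_nonneg)
  have "A *v (2 *\<^sub>R p - (p - u)) = A *v p + A *v u"
    unfolding matrix_vector_mult_reflection
    unfolding matrix_vector_mult_diff_distrib by simp
  also have "\<dots> = b + (1 / \<tau>) *\<^sub>R s"
    by (simp add: p w pdhg_matrix_def)
  finally have y': "A *v (2 *\<^sub>R p - (p - u)) = b + (1 / \<tau>) *\<^sub>R s" .
  have "?D (p - u, - y - s) = w"
    unfolding pdhg_def prod.case Let_def x' y' w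
    using assms by (simp add: scaleR_add_right minus_prod_def)
  from this[symmetric] show "w \<in> range ?D"
    by (rule range_eqI)
qed

section \<open>Separation of the variational inequality and the certificates\<close>

text \<open>Testing with \<open>0\<close> and \<open>p + p\<close> gives both signs of
  \<open>v \<bullet> p\<close>.\<close>

lemma convex_cone_variational_inequality:
  fixes v :: "'a::euclidean_space"
  assumes "convex_cone C" "p \<in> C" "\<And>q. q \<in> C \<Longrightarrow> 0 \<le> v \<bullet> (q - p)"
  shows "v \<bullet> p = 0" "q \<in> C \<Longrightarrow> 0 \<le> v \<bullet> q"
proof -
  have "0 \<in> C" "p + p \<in> C"
    using assms convex_cone_add convex_cone_contains_0 by blast+
  then show "v \<bullet> p = 0"
    using assms(3)[of 0] assms(3)[of "p + p"] by simp
  then show "0 \<le> v \<bullet> q" if "q \<in> C"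
    using assms(3)[OF that] by (simp add: inner_diff_right)
qed

theorem proposition4:
  fixes A :: "real^'n^'m" and b :: "real^'m" and c :: "real^'n"
    and \<eta> \<tau> :: real and v\<^sub>x :: "real^'n" and v\<^sub>y :: "real^'m"
  assumes "\<eta> > 0" and "\<tau> > 0"
    and "\<eta> * \<tau> * (onorm (\<lambda>x. A *v x))\<^sup>2 < 1"
    and "(v\<^sub>x, v\<^sub>y) = infimal_displacement A b c \<eta> \<tau>"
  shows "(primal_feasible_set A b = {} \<longleftrightarrow> v\<^sub>y \<noteq> 0)
    \<and> (primal_feasible_set A b = {} \<longrightarrow>
         b \<bullet> v\<^sub>y < 0 \<and> 0 \<le> transpose A *v v\<^sub>y)
    \<and> (dual_feasible_set A c = {} \<longleftrightarrow> v\<^sub>x \<noteq> 0)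
    \<and> (dual_feasible_set A c = {} \<longrightarrow>
         c \<bullet> v\<^sub>x < 0 \<and> A *v v\<^sub>x = 0 \<and> 0 \<le> v\<^sub>x)"
proof -
  let ?M = "pdhg_matrix A \<eta> \<tau>"
  define S where "S = {w. dual_feasible_set A (c + fst (?M w)) \<noteq> {}
    \<and> primal_feasible_set A (b + snd (?M w)) \<noteq> {}}"
  have range: "range (\<lambda>z. pdhg A b c \<eta> \<tau> z - z) = S"
    unfolding S_def using assms(1,2) by (rule range_pdhg_displacement)
  let ?K = "{(g, h). dual_feasible_set A (c + g) \<noteq> {} \<and> primal_feasible_set A (b + h) \<noteq> {}}"
  \<comment> \<open>Translation and linear preimage preserve closedness and convexity, so
    \<open>S\<close> inherits both from the product of the two cones.\<close>
  have K: "?K = (\<lambda>k. - (c, b) + k) `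
      ({c. dual_feasible_set A c \<noteq> {}} \<times> {b. primal_feasible_set A b \<noteq> {}})"
    (is "_ = _ ` (?C \<times> ?B)")
  proof (intro equalityI subsetI)
    fix k
    assume "k \<in> ?K"
    then show "k \<in> (\<lambda>k. - (c, b) + k) ` (?C \<times> ?B)"
      by (intro image_eqI[of _ _ "(c, b) + k"]) (auto simp: zero_prod_def)
  qed (auto simp: zero_prod_def)
  have S: "S = ?M -` ?K"
    by (auto simp: S_def mem_Times_iff)
  have "closed S"
    unfolding S K
    by (intro continuous_closed_vimage closed_translation closed_Times closed_primal_feasible
        closed_dual_feasible linear_continuous_at linear_linear[THEN iffD2] linear_pdhg_matrix)
  have "convex S"
    unfolding S K
    using convex_cone_dual_feasible[of A] convex_cone_primal_feasible[of A]
    by (intro convex_linear_vimage linear_pdhg_matrix convex_translation convex_Times)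
      (simp_all add: convex_cone_def)
  have "S \<noteq> {}"
    using range by blast
  obtain \<alpha> where "\<alpha> > 0" "\<And>z. \<alpha> * (z \<bullet> z) \<le> z \<bullet> ?M z"
    using pdhg_matrix_coercive assms by blast
  note min = linear_pdhg_matrix pdhg_matrix_symmetric this \<open>closed S\<close> \<open>convex S\<close> \<open>S \<noteq> {}\<close>
  have "is_arg_min (pdhg_norm A \<eta> \<tau>) (\<lambda>w. w \<in> S) (v\<^sub>x, v\<^sub>y)"
    unfolding assms(4) infimal_displacement_def range closure_closed[OF \<open>closed S\<close>] pdhg_norm_def
    by (rule theI', rule quadratic_form_minimizer_ex1[OF min])
  then have v_min: "is_arg_min (\<lambda>z. sqrt (z \<bullet> ?M z)) (\<lambda>w. w \<in> S) (v\<^sub>x, v\<^sub>y)"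
    by (simp add: pdhg_norm_def[abs_def])
  define g where "g = fst (?M (v\<^sub>x, v\<^sub>y))"
  define h where "h = snd (?M (v\<^sub>x, v\<^sub>y))"
  have g: "g = (1 / \<eta>) *\<^sub>R v\<^sub>x - transpose A *v v\<^sub>y" and h: "h = - (A *v v\<^sub>x) + (1 / \<tau>) *\<^sub>R v\<^sub>y"
    by (simp_all add: g_def h_def pdhg_matrix_def)
  have "c + g \<in> ?C" "b + h \<in> ?B"
    using v_min by (simp_all add: is_arg_min_def S_def g_def h_def)
  \<comment> \<open>An injective linear map of a finite-dimensional space to itself is onto, so
    \<open>?M w\<close> reaches every pair \<open>(p - c, q - b)\<close> and \<open>p\<close>,
    \<open>q\<close> vary independently below.\<close>
  have "inj ?M"
  proof -
    have "z \<bullet> z \<le> 0" if "?M z = 0" for z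
      using \<open>\<alpha> * (z \<bullet> z) \<le> z \<bullet> ?M z\<close> \<open>\<alpha> > 0\<close> that by (auto simp: mult_le_0_iff)
    then have "z = 0" if "?M z = 0" for z
      using that by (metis inner_eq_zero_iff inner_ge_zero order_antisym)
    then show ?thesis
      using linear_injective_0[OF linear_pdhg_matrix] by blast
  qed
  then have surj: "surj ?M"
    using linear_pdhg_matrix linear_injective_imp_surjective by blast
  have var: "0 \<le> v\<^sub>x \<bullet> (p - (c + g)) + v\<^sub>y \<bullet> (q - (b + h))" if "p \<in> ?C" "q \<in> ?B" for p q
  proof -
    obtain w where w: "?M w = (p - c, q - b)"
      using surj by (metis surjD)
    then have "w \<in> S"
      using that by (simp add: S_def)
    with v_min have "0 \<le> (v\<^sub>x, v\<^sub>y) \<bullet> (?M w - ?M (v\<^sub>x, v\<^sub>y))"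
      using quadratic_form_minimizer_variational[OF min] by blast
    moreover have "?M (v\<^sub>x, v\<^sub>y) = (g, h)"
      by (simp add: g_def h_def)
    ultimately show ?thesis
      by (simp add: w algebra_simps)
  qed
  \<comment> \<open>Fixing the other component at its value at the minimizer makes its term
    vanish.\<close>
  have var_x: "0 \<le> v\<^sub>x \<bullet> (p - (c + g))" if "p \<in> ?C" for p
    using var[OF that \<open>b + h \<in> ?B\<close>] by simp
  have var_y: "0 \<le> v\<^sub>y \<bullet> (q - (b + h))" if "q \<in> ?B" for q
    using var[OF \<open>c + g \<in> ?C\<close> that] by simp
  note x = convex_cone_variational_inequality[OF convex_cone_dual_feasible \<open>c + g \<in> ?C\<close> var_x]
  note y = convex_cone_variational_inequality[OF convex_cone_primal_feasible \<open>b + h \<in> ?B\<close> var_y]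
  have x_ge: "0 \<le> v\<^sub>x \<bullet> p" if "transpose A *v y' \<le> p" for p y'
    using that by (intro x(2)) (auto simp: dual_feasible_set_def)
  have y_ge: "0 \<le> v\<^sub>y \<bullet> (A *v x')" if "0 \<le> x'" for x'
    using that by (intro y(2)) (auto simp: primal_feasible_set_def)
  have "0 \<le> v\<^sub>x"
    unfolding nonneg_iff_inner_nonneg[of "v\<^sub>x"] using x_ge[of 0] by simp
  \<comment> \<open>Testing with \<open>p = transpose A *v y'\<close> for
    \<open>y' = - (A *v v\<^sub>x)\<close> gives minus the squared norm of
    \<open>A *v v\<^sub>x\<close>.\<close>
  have "A *v v\<^sub>x = 0"
    using x_ge[OF order_refl, of "- (A *v v\<^sub>x)"]
    by (simp add: inner_matrix_vector_mult[of "v\<^sub>x" "transpose A"] order_antisym_conv)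
  have "0 \<le> transpose A *v v\<^sub>y"
    unfolding nonneg_iff_inner_nonneg[of "transpose A *v v\<^sub>y"]
    using y_ge by (simp add: inner_matrix_vector_mult)
  \<comment> \<open>In the orthogonality of \<open>v\<^sub>x\<close> and \<open>c + g\<close>,
    \<open>A *v v\<^sub>x = 0\<close> removes the cross term of \<open>g\<close>; likewise for
    \<open>b_y\<close>.\<close>
  have c_x: "c \<bullet> v\<^sub>x = - (v\<^sub>x \<bullet> v\<^sub>x) / \<eta>"
    using x(1) \<open>A *v v\<^sub>x = 0\<close>
    by (simp add: g inner_simps inner_matrix_vector_mult inner_commute)
  have b_y: "b \<bullet> v\<^sub>y = - (v\<^sub>y \<bullet> v\<^sub>y) / \<tau>"
    using y(1) \<open>A *v v\<^sub>x = 0\<close> by (simp add: h inner_simps inner_commute)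
  have c_neg: "c \<bullet> v\<^sub>x < 0" if "v\<^sub>x \<noteq> 0"
    using that assms(1) by (simp add: c_x)
  have b_neg: "b \<bullet> v\<^sub>y < 0" if "v\<^sub>y \<noteq> 0"
    using that assms(2) by (simp add: b_y)
  have c_nonneg: "0 \<le> c \<bullet> v\<^sub>x" if "dual_feasible_set A c \<noteq> {}"
    using x(2)[of c] that by (simp add: inner_commute)
  have b_nonneg: "0 \<le> b \<bullet> v\<^sub>y" if "primal_feasible_set A b \<noteq> {}"
    using y(2)[of b] that by (simp add: inner_commute)
  \<comment> \<open>Now \<open>g\<close> is \<open>- (transpose A *v v\<^sub>y)\<close>, which a
    shift of the dual variable by \<open>v\<^sub>y\<close> absorbs.\<close>
  have dual_feasible: "dual_feasible_set A c \<noteq> {}" if "v\<^sub>x = 0"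
  proof -
    have "c + g = c - transpose A *v v\<^sub>y"
      using that by (simp add: g)
    with \<open>c + g \<in> ?C\<close> obtain y' where "transpose A *v y' \<le> c - transpose A *v v\<^sub>y"
      unfolding dual_feasible_set_def by auto
    then have "y' + v\<^sub>y \<in> dual_feasible_set A c"
      by (simp add: dual_feasible_set_def algebra_simps)
    then show ?thesis by blast
  qed
  have primal_feasible: "primal_feasible_set A b \<noteq> {}" if "v\<^sub>y = 0"
    using \<open>b + h \<in> ?B\<close> that \<open>A *v v\<^sub>x = 0\<close> by (simp add: h)
  have "primal_feasible_set A b = {} \<longleftrightarrow> v\<^sub>y \<noteq> 0"
    using b_neg b_nonneg primal_feasible by linarith
  moreover have "dual_feasible_set A c = {} \<longleftrightarrow> v\<^sub>x \<noteq> 0"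
    using c_neg c_nonneg dual_feasible by linarith
  ultimately show ?thesis
    using \<open>0 \<le> v\<^sub>x\<close> \<open>A *v v\<^sub>x = 0\<close> \<open>0 \<le> transpose A *v v\<^sub>y\<close> b_neg c_neg by blast
qed

end
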